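(* Let $(\mathcal{Z},\mathfrak{Z})$ be a measurable space, $P$ a probability measure on it, $\alpha>0$, and let $\ell:\mathcal{Z}\to(-\infty,\infty]$ be measurable, $\ell\in\mathcal{L}^1(P)$, and bounded below $P$-almost surely. Let $f:[0,\infty)\to(-\infty,\infty]$ be proper, lower semicontinuous and convex, finite, differentiable and strictly convex on $(0,\infty)$, with $f(1)=0$, $f(t)\ge 0$ for all $t\ge 0$ with equality only at $t=1$, $\lim_{t\downarrow 0}f'(t)\in[-\infty,\infty)$, and $\lim_{t\uparrow\infty}f'(t)=\infty$. Let $\mathcal{U}$ be the set of measurable $u:\mathcal{Z}\to[0,\infty)$ with $\int_{\mathcal{Z}}u\,\mathrm{d}P=1$. Then $$\inf_{u\in\mathcal{U}}\int_{\mathcal{Z}}\{\ell u+\alpha f(u)\}\,\mathrm{d}P=\sup_{\lambda\in\mathbb{R}}\left\{-\lambda-\alpha\int_{\mathcal{Z}}f^*\!\left(-\frac{\ell+\lambda}{\alpha}\right)\mathrm{d}P\right\}.$$ The supremum is attained at $\lambda=\lambda^\star$, where $\lambda^\star$ is the unique real number such that $\int_{\mathcal{Z}}u_{\lambda^\star}\,\mathrm{d}P=1$, with $u_\lambda(z)=\mathrm{arg\,min}_{t\ge 0}\{\alpha f(t)+(\ell(z)+\lambda)t\}$ for $P$-a.e. $z$.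
   Context: Extend $f$ by $f(t)=\infty$ for $t<0$; $f^*(y)=\sup_{t\in\mathbb{R}}\{ty-f(t)\}$ is its Fenchel conjugate. Integrals are extended integrals in $(-\infty,\infty]$, defined whenever the negative part of the integrand has finite integral. Under the stated hypotheses, for each $\lambda$ the scalar minimizer $u_\lambda(z)$ exists and is unique for every $z$ with $\ell(z)<\infty$ (hence $P$-a.e.), and there is exactly one $\lambda^\star\in\mathbb{R}$ with $\int_{\mathcal{Z}}u_{\lambda^\star}\,\mathrm{d}P=1$. *)

theory Defs
  imports "HOL-Probability.Probability"
begin

text \<open>Arithmetic on \<open>ereal\<close> follows the library, in particular \<open>\<infinity> * 0 = 0\<close>. For
  functions that do not take the value \<open>-\<infinity>\<close>, none of the sums and differences below has the form
  \<open>\<infinity> - \<infinity>\<close>, with \<open>ext_integral\<close> restricted as stated there.\<close>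

definition proper_on :: "'a set \<Rightarrow> ('a \<Rightarrow> ereal) \<Rightarrow> bool" where
  "proper_on S f \<longleftrightarrow> (\<forall>x\<in>S. f x \<noteq> -\<infinity>) \<and> (\<exists>x\<in>S. f x \<noteq> \<infinity>)"

definition lsc_on :: "'a::topological_space set \<Rightarrow> ('a \<Rightarrow> ereal) \<Rightarrow> bool" where
  "lsc_on S f \<longleftrightarrow> (\<forall>x\<in>S. f x \<le> Liminf (at x within S) f)"

definition ereal_convex_on :: "'a::real_vector set \<Rightarrow> ('a \<Rightarrow> ereal) \<Rightarrow> bool" where
  "ereal_convex_on S f \<longleftrightarrow> convex S \<and>
     (\<forall>x\<in>S. \<forall>y\<in>S. \<forall>c\<in>{0<..<1}.
        f ((1 - c) *\<^sub>R x + c *\<^sub>R y) \<le> ereal (1 - c) * f x + ereal c * f y)"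

definition ereal_strictly_convex_on :: "'a::real_vector set \<Rightarrow> ('a \<Rightarrow> ereal) \<Rightarrow> bool" where
  "ereal_strictly_convex_on S f \<longleftrightarrow> convex S \<and>
     (\<forall>x\<in>S. \<forall>y\<in>S. \<forall>c\<in>{0<..<1}. x \<noteq> y \<longrightarrow>
        f ((1 - c) *\<^sub>R x + c *\<^sub>R y) < ereal (1 - c) * f x + ereal c * f y)"

text \<open>A function on \<open>[0, \<infinity>)\<close> is a total function whose values at negative arguments are
  ignored; this is its extension by \<open>\<infinity>\<close>.\<close>

definition extend_inf :: "(real \<Rightarrow> ereal) \<Rightarrow> real \<Rightarrow> ereal" where
  "extend_inf f t = (if t < 0 then \<infinity> else f t)"

definition fenchel_conj :: "(real \<Rightarrow> ereal) \<Rightarrow> real \<Rightarrow> ereal" where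
  "fenchel_conj g y = (SUP t. ereal (t * y) - g t)"

text \<open>The Bochner integral does not cover extended-real integrands. The integral below is
  meaningful, with values in \<open>(-\<infinity>, \<infinity>]\<close>, under \<open>ext_integrable\<close>; note that \<open>e2ennreal\<close>
  truncates negative arguments to \<open>0\<close>.\<close>

definition ext_integrable :: "'a measure \<Rightarrow> ('a \<Rightarrow> ereal) \<Rightarrow> bool" where
  "ext_integrable M g \<longleftrightarrow> g \<in> borel_measurable M \<and> (\<integral>\<^sup>+z. e2ennreal (- g z) \<partial>M) < \<infinity>"

definition ext_integral :: "'a measure \<Rightarrow> ('a \<Rightarrow> ereal) \<Rightarrow> ereal" where
  "ext_integral M g =
     enn2ereal (\<integral>\<^sup>+z. e2ennreal (g z) \<partial>M) - enn2ereal (\<integral>\<^sup>+z. e2ennreal (- g z) \<partial>M)"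

definition ereal_L1 :: "'a measure \<Rightarrow> ('a \<Rightarrow> ereal) \<Rightarrow> bool" where
  "ereal_L1 M g \<longleftrightarrow> g \<in> borel_measurable M \<and> (\<integral>\<^sup>+z. e2ennreal \<bar>g z\<bar> \<partial>M) < \<infinity>"

definition unit_densities :: "'a measure \<Rightarrow> ('a \<Rightarrow> real) set" where
  "unit_densities M =
     {u \<in> borel_measurable M. (\<forall>z\<in>space M. 0 \<le> u z) \<and> has_bochner_integral M u 1}"

definition primal_integrand ::
    "real \<Rightarrow> ('a \<Rightarrow> ereal) \<Rightarrow> (real \<Rightarrow> ereal) \<Rightarrow> ('a \<Rightarrow> real) \<Rightarrow> 'a \<Rightarrow> ereal" where
  "primal_integrand \<alpha> l f u z = l z * ereal (u z) + ereal \<alpha> * f (u z)"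

text \<open>The conjugate takes real arguments. For \<open>l \<in> L\<^sup>1\<close> the points with \<open>l z = \<infinity>\<close>, where
  \<open>real_of_ereal (l z) = 0\<close>, form a null set and do not affect the integral.\<close>

definition dual_integrand ::
    "real \<Rightarrow> ('a \<Rightarrow> ereal) \<Rightarrow> (real \<Rightarrow> ereal) \<Rightarrow> real \<Rightarrow> 'a \<Rightarrow> ereal" where
  "dual_integrand \<alpha> l f lam z =
     fenchel_conj (extend_inf f) (- (real_of_ereal (l z) + lam) / \<alpha>)"

definition dual_objective ::
    "'a measure \<Rightarrow> real \<Rightarrow> ('a \<Rightarrow> ereal) \<Rightarrow> (real \<Rightarrow> ereal) \<Rightarrow> real \<Rightarrow> ereal" where
  "dual_objective M \<alpha> l f lam =
     - ereal lam - ereal \<alpha> * ext_integral M (dual_integrand \<alpha> l f lam)"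

definition scalar_objective ::
    "real \<Rightarrow> ('a \<Rightarrow> ereal) \<Rightarrow> (real \<Rightarrow> ereal) \<Rightarrow> real \<Rightarrow> 'a \<Rightarrow> real \<Rightarrow> ereal" where
  "scalar_objective \<alpha> l f lam z t = ereal \<alpha> * f t + (l z + ereal lam) * ereal t"

definition scalar_minimizer ::
    "real \<Rightarrow> ('a \<Rightarrow> ereal) \<Rightarrow> (real \<Rightarrow> ereal) \<Rightarrow> real \<Rightarrow> 'a \<Rightarrow> real" where
  "scalar_minimizer \<alpha> l f lam z = arg_min (scalar_objective \<alpha> l f lam z) (\<lambda>t. 0 \<le> t)"

end

theory Submission
  imports Defs
begin

text \<open>For every slope \<open>y\<close> the function \<open>t y - f t\<close> has exactly one maximizer \<open>T y \<ge> 0\<close>, by coercivity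
  and strict convexity. \<open>T\<close> is monotone, continuous, unbounded, injective where positive, and
  \<open>T 0 = 1\<close> because \<open>f\<close> is minimal at \<open>1\<close>. Since \<open>l\<close> is bounded below, \<open>u\<^sub>\<lambda> = T (- (l + \<lambda>) / \<alpha>)\<close> is
  bounded, its integral is continuous and decreasing in \<open>\<lambda>\<close>, and the intermediate value theorem
  yields the multiplier with integral \<open>1\<close>. Integrating the Fenchel-Young inequality gives weak
  duality, and it is an equality at that multiplier.\<close>

section \<open>Real-valued form of the divergence, its convexity and continuity\<close>

locale divergence_fn =
  fixes f :: "real \<Rightarrow> ereal"
  assumes conv: "ereal_convex_on {0..} f"
    and lsc: "lsc_on {0..} f"
    and fin: "\<And>t. t > 0 \<Longrightarrow> \<bar>f t\<bar> \<noteq> \<infinity>"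
    and diff: "\<And>t. t > 0 \<Longrightarrow> (\<lambda>s. real_of_ereal (f s)) differentiable (at t)"
    and strict: "ereal_strictly_convex_on {0<..} f"
    and f_one: "f 1 = 0"
    and nonneg: "\<And>t. t \<ge> 0 \<Longrightarrow> f t \<ge> 0"
    and deriv_top: "filterlim (deriv (\<lambda>s. real_of_ereal (f s))) at_top at_top"
begin

text \<open>\<open>real_of_ereal\<close> sends \<open>\<infinity>\<close> to 0, so \<open>g\<close>
  represents \<open>f\<close> only on \<open>dom\<close>. That set is \<open>{0..}\<close> or
  \<open>{0<..}\<close>, according to whether \<open>f 0\<close> is finite.\<close>

definition g :: "real \<Rightarrow> real" where "g t = real_of_ereal (f t)"

definition dom :: "real set" where "dom = {t. 0 \<le> t \<and> f t \<noteq> \<infinity>}"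

lemma dom_nonneg: "t \<in> dom \<Longrightarrow> 0 \<le> t"
  by (simp add: dom_def)

lemma pos_dom: "t > 0 \<Longrightarrow> t \<in> dom"
  using fin[of t] by (auto simp: dom_def)

lemma f_eq_g: "t \<in> dom \<Longrightarrow> f t = ereal (g t)"
  using nonneg[of t] by (auto simp: dom_def g_def ereal_real)

lemma f_outside: "0 \<le> t \<Longrightarrow> t \<notin> dom \<Longrightarrow> f t = \<infinity>"
  by (simp add: dom_def)

lemma g_one: "g 1 = 0"
  by (simp add: g_def f_one)

lemma g_nonneg: "t \<in> dom \<Longrightarrow> 0 \<le> g t"
  using nonneg[of t] f_eq_g[of t] dom_nonneg[of t] by simp

lemma f_combination:
  assumes "x \<in> dom" "y \<in> dom" "0 < c" "c < 1"
  shows "f ((1 - c) * x + c * y) \<le> ereal ((1 - c) * g x + c * g y)"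
proof -
  have "x \<in> {0..}" "y \<in> {0..}" "c \<in> {0<..<1}"
    using assms dom_nonneg by auto
  with conv have "f ((1 - c) *\<^sub>R x + c *\<^sub>R y) \<le> ereal (1 - c) * f x + ereal c * f y"
    unfolding ereal_convex_on_def by blast
  then show ?thesis using assms by (simp add: f_eq_g)
qed

lemma convex_on_g: "convex_on dom g"
proof (rule convex_onI)
  have in_dom: "(1 - c) * x + c * y \<in> dom" if "x \<in> dom" "y \<in> dom" "0 < c" "c < 1" for c x y
    using f_combination[OF that] that by (auto simp: dom_def)
  show "g ((1 - c) *\<^sub>R x + c *\<^sub>R y) \<le> (1 - c) * g x + c * g y"
    if "0 < c" "c < 1" "x \<in> dom" "y \<in> dom" for c x y
    using f_combination[of x y c] f_eq_g[OF in_dom[of x y c]] that by simp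
  show "convex dom"
    unfolding convex_alt
  proof (intro ballI allI impI)
    fix x y c :: real
    assume *: "x \<in> dom" "y \<in> dom" "0 \<le> c \<and> c \<le> 1"
    then consider "c = 0" | "c = 1" | "0 < c" "c < 1" by force
    then show "(1 - c) *\<^sub>R x + c *\<^sub>R y \<in> dom"
      using * in_dom by cases auto
  qed
qed

lemma has_derivative_g: "t > 0 \<Longrightarrow> (g has_real_derivative deriv g t) (at t)"
  using diff[of t] unfolding g_def
  by (metis DERIV_deriv_iff_real_differentiable)

text \<open>A point \<open>t > 0\<close> is interior to \<open>dom\<close>, so the tangent at
  \<open>t\<close> supports \<open>g\<close> on all of \<open>dom\<close>, including 0 if it belongs
  to it.\<close>

lemma g_above_tangent:
  assumes "t > 0" "s \<in> dom"
  shows "g t + deriv g t * (s - t) \<le> g s"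
proof -
  have "{0<..} \<subseteq> interior dom"
    using pos_dom by (intro interior_maximal) auto
  then have "t \<in> interior dom" using assms by auto
  moreover have "connected dom"
    by (intro convex_connected convex_on_imp_convex[OF convex_on_g])
  ultimately have "g s - g t \<ge> deriv g t * (s - t)"
    using convex_on_imp_above_tangent[OF convex_on_g _ _ assms(2)]
      has_field_derivative_at_within[OF has_derivative_g[OF assms(1)]] by blast
  then show ?thesis by simp
qed

text \<open>Continuity is meant in the topology of \<open>ereal\<close>. At positive points it comes
  from differentiability; at 0, lower semicontinuity gives one half and convexity the other.\<close>

lemma continuous_on_f: "continuous_on {0..} f"
  unfolding continuous_on_eq_continuous_within
proof
  fix x :: real
  assume x: "x \<in> {0..}"
  show "continuous (at x within {0..}) f"
  proof (cases "x = 0")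
    case False
    with x have x: "x > 0" by simp
    have "isCont g x"
      using has_derivative_g[OF x] DERIV_isCont by blast
    then have "((\<lambda>t. ereal (g t)) \<longlongrightarrow> ereal (g x)) (at x)"
      by (simp add: isCont_def)
    moreover have "\<forall>\<^sub>F t in at x. ereal (g t) = f t"
      using x
      by (auto simp: eventually_at_topological f_eq_g pos_dom intro!: exI[of _ "{0<..}"])
    ultimately have "(f \<longlongrightarrow> f x) (at x)"
      using x Lim_transform_eventually by (fastforce simp: f_eq_g pos_dom)
    then show ?thesis
      by (simp add: continuous_within tendsto_within_subset[of _ _ _ UNIV])
  next
    case True
    have lower: "f 0 \<le> Liminf (at 0 within {0..}) f"
      using lsc by (simp add: lsc_on_def)
    have upper: "Limsup (at 0 within {0..}) f \<le> f 0"
    proof (cases "0 \<in> dom")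
      case True
      \<comment> \<open>On \<open>[0, 1]\<close> the graph of \<open>f\<close> lies below the chord
        from \<open>(0, g 0)\<close> to \<open>(1, 0)\<close>, which tends to
        \<open>g 0\<close>.\<close>
      have "((\<lambda>t. ereal ((1 - t) * g 0)) \<longlongrightarrow> ereal ((1 - 0) * g 0)) (at 0 within {0..})"
        by (intro tendsto_intros)
      then have "Limsup (at 0 within {0..}) (\<lambda>t. ereal ((1 - t) * g 0)) = f 0"
        using lim_imp_Limsup[of "at (0::real) within {0..}"
            "\<lambda>t. ereal ((1 - t) * g 0)" "ereal (g 0)"] True
        by (simp add: f_eq_g trivial_limit_at_right_real at_within_Ici_at_right)
      moreover have "Limsup (at 0 within {0..}) f
          \<le> Limsup (at 0 within {0..}) (\<lambda>t. ereal ((1 - t) * g 0))"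
      proof (rule Limsup_mono)
        show "\<forall>\<^sub>F t in at 0 within {0..}. f t \<le> ereal ((1 - t) * g 0)"
          unfolding eventually_at_topological
          using f_combination[OF True pos_dom[of 1]]
          by (intro exI[of _ "{-1<..<1}"]) (auto simp: g_one)
      qed
      ultimately show ?thesis by simp
    qed (simp add: dom_def)
    have nontrivial: "at (0::real) within {0..} \<noteq> bot"
      by (simp add: at_within_Ici_at_right)
    then have "Liminf (at 0 within {0..}) f \<le> Limsup (at 0 within {0..}) f"
      by (rule Liminf_le_Limsup)
    then have "(f \<longlongrightarrow> f 0) (at 0 within {0..})"
      using lower upper by (intro Liminf_eq_Limsup[OF nontrivial]) simp_all
    then show ?thesis
      using True by (simp add: continuous_within)
  qed
qed

section \<open>The maximizer in the Fenchel conjugate as a function of the slope\<close>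

definition conj_maximizer :: "real \<Rightarrow> real \<Rightarrow> bool" where
  "conj_maximizer y t \<longleftrightarrow> t \<in> dom \<and> (\<forall>s\<in>dom. s * y - g s \<le> t * y - g t)"

text \<open>Once \<open>deriv g K \<ge> y\<close>, the tangent at \<open>K\<close> shows that no
  point beyond \<open>K\<close> beats \<open>K\<close>. The problem thus reduces to the compact
  interval \<open>[0, K]\<close>.\<close>

lemma ex_conj_maximizer: "\<exists>t. conj_maximizer y t"
proof -
  have "\<forall>\<^sub>F t in at_top. y \<le> deriv g t"
    using deriv_top unfolding filterlim_at_top g_def[abs_def] by blast
  then obtain N where N: "\<And>t. N \<le> t \<Longrightarrow> y \<le> deriv g t"
    unfolding eventually_at_top_linorder by blast
  \<comment> \<open>The maximum with 1 makes \<open>K\<close> positive, as the tangent requires, and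
    puts the point 1, where \<open>f\<close> is finite, into the interval.\<close>
  define K where "K = max N 1"
  have K: "y \<le> deriv g K" "1 \<le> K"
    using N by (auto simp: K_def)
  let ?h = "\<lambda>t. f t + ereal (- (t * y))"
  have "continuous_on {0..K} ?h"
    unfolding continuous_on_def
  proof
    fix x assume x: "x \<in> {0..K}"
    have "(f \<longlongrightarrow> f x) (at x within {0..K})"
      using continuous_on_subset[OF continuous_on_f, of "{0..K}"] x
      by (auto simp: continuous_on_def)
    moreover have "((\<lambda>t. ereal (- (t * y))) \<longlongrightarrow> ereal (- (x * y))) (at x within {0..K})"
      by (intro tendsto_intros)
    ultimately show "(?h \<longlongrightarrow> ?h x) (at x within {0..K})"
      by (intro tendsto_add_ereal_general) auto
  qed
  then obtain p where p: "p \<in> {0..K}" "\<And>s. s \<in> {0..K} \<Longrightarrow> ?h p \<le> ?h s"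
    using continuous_attains_inf[of "{0..K}" ?h] K by (metis atLeastatMost_empty_iff2
      compact_Icc order.trans zero_le_one)
  \<comment> \<open>Comparison with the point 1 shows that the minimum is finite.\<close>
  have "?h p \<le> ereal (- y)"
    using p(2)[of 1] K by (simp add: f_one)
  then have p_dom: "p \<in> dom"
    using p(1) by (auto simp: dom_def)
  have p_best: "s * y - g s \<le> p * y - g p" if "s \<in> dom" "s \<le> K" for s
    using p(2)[of s] that p_dom by (simp add: f_eq_g dom_nonneg)
  have "s * y - g s \<le> p * y - g p" if s: "s \<in> dom" for s
  proof (cases "s \<le> K")
    case False
    have "y * (s - K) \<le> deriv g K * (s - K)"
      using K False by (intro mult_right_mono) auto
    then have "s * y - g s \<le> K * y - g K"
      using g_above_tangent[of K s] s K by (simp add: algebra_simps)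
    also have "\<dots> \<le> p * y - g p"
      using p_best[of K] K pos_dom by simp
    finally show ?thesis .
  qed (use p_best s in blast)
  then show ?thesis
    using p_dom unfolding conj_maximizer_def by blast
qed

lemma g_strict:
  assumes "0 < x" "0 < y" "x \<noteq> y"
  shows "g ((x + y) / 2) < (g x + g y) / 2"
proof -
  have "(1/2::real) \<in> {0<..<1}" by simp
  with strict assms have "f ((1 - 1/2) *\<^sub>R x + (1/2) *\<^sub>R y)
      < ereal (1 - 1/2) * f x + ereal (1/2) * f y"
    unfolding ereal_strictly_convex_on_def by (metis greaterThan_iff)
  moreover have "(1 - 1/2) *\<^sub>R x + (1/2) *\<^sub>R y = (x + y) / 2"
    by (simp add: field_simps)
  ultimately show ?thesis
    using assms pos_dom[of "(x + y) / 2"] by (simp add: f_eq_g pos_dom field_simps)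
qed

text \<open>Strict convexity is available only on positive arguments, while the smaller of two
  maximizers \<open>p < q\<close> might be 0. By plain convexity their midpoint \<open>a\<close> is
  also a maximizer, and it is positive; strict convexity between \<open>a\<close> and
  \<open>q\<close> then gives the contradiction.\<close>

lemma conj_maximizer_unique:
  assumes "conj_maximizer y p" "conj_maximizer y q"
  shows "p = q"
proof -
  have less: False if p: "conj_maximizer y p" and q: "conj_maximizer y q" and "p < q" for p q
  proof -
    define a where "a = (p + q) / 2"
    have dom: "p \<in> dom" "q \<in> dom" using p q by (auto simp: conj_maximizer_def)
    then have pos: "0 < a" "0 < q" "a \<noteq> q"
      using \<open>p < q\<close> dom_nonneg[of p] by (auto simp: a_def)
    have "g a \<le> (g p + g q) / 2"
      using convex_onD[OF convex_on_g, of "1/2" p q] dom by (simp add: a_def field_simps)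
    moreover have "p * y - g p = q * y - g q"
      using p q dom by (intro antisym) (auto simp: conj_maximizer_def)
    ultimately have "q * y - g q \<le> a * y - g a"
      by (simp add: a_def field_simps)
    moreover have "(a + q) / 2 * y - g ((a + q) / 2) \<le> q * y - g q"
      using q pos pos_dom[of "(a + q) / 2"] by (auto simp: conj_maximizer_def)
    ultimately show False
      using g_strict[OF pos] by (simp add: field_simps)
  qed
  show ?thesis
    using less[of p q] less[of q p] assms by (cases p q rule: linorder_cases) auto
qed

text \<open>This is the inverse of \<open>deriv g\<close>, extended by 0 to the slopes that
  \<open>deriv g\<close> does not attain on positive arguments.\<close>

definition conj_argmax :: "real \<Rightarrow> real" where
  "conj_argmax y = (THE t. conj_maximizer y t)"

lemma conj_maximizer_argmax: "conj_maximizer y (conj_argmax y)"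
  unfolding conj_argmax_def
proof (rule theI')
  show "\<exists>!t. conj_maximizer y t"
    using ex_conj_maximizer[of y] conj_maximizer_unique[of y] by auto
qed

lemma conj_argmax_eqI: "conj_maximizer y t \<Longrightarrow> conj_argmax y = t"
  by (rule conj_maximizer_unique[OF conj_maximizer_argmax])

lemma conj_argmax_dom: "conj_argmax y \<in> dom"
  using conj_maximizer_argmax by (simp add: conj_maximizer_def)

lemma conj_argmax_nonneg: "0 \<le> conj_argmax y"
  by (simp add: conj_argmax_dom dom_nonneg)

lemma conj_argmax_best: "s \<in> dom \<Longrightarrow> s * y - g s \<le> conj_argmax y * y - g (conj_argmax y)"
  using conj_maximizer_argmax by (simp add: conj_maximizer_def)

text \<open>The tangent inequality at \<open>t\<close> is exactly the optimality of \<open>t\<close>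
  for the slope \<open>deriv g t\<close>. Hence every positive number is a value of
  \<open>conj_argmax\<close>.\<close>

lemma conj_argmax_deriv: "t > 0 \<Longrightarrow> conj_argmax (deriv g t) = t"
  using g_above_tangent[of t] pos_dom[of t]
  by (intro conj_argmax_eqI) (auto simp: conj_maximizer_def algebra_simps)

lemma conj_argmax_zero: "conj_argmax 0 = 1"
  using g_nonneg pos_dom[of 1]
  by (intro conj_argmax_eqI) (auto simp: conj_maximizer_def g_one)

text \<open>Testing the optimality of each maximizer against the other and adding yields
  \<open>(conj_argmax x - conj_argmax y) * (y - x) \<le> 0\<close>.\<close>

lemma conj_argmax_mono:
  assumes "x \<le> y"
  shows "conj_argmax x \<le> conj_argmax y"
proof (rule ccontr)
  assume "\<not> ?thesis"
  then have "0 \<le> (conj_argmax x - conj_argmax y) * (y - x)"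
    using assms by simp
  moreover have "(conj_argmax x - conj_argmax y) * (y - x) \<le> 0"
    using conj_argmax_best[OF conj_argmax_dom, of x y] conj_argmax_best[OF conj_argmax_dom, of y x]
    by (simp add: algebra_simps)
  ultimately have "(conj_argmax x - conj_argmax y) * (y - x) = 0"
    by simp
  with \<open>\<not> ?thesis\<close> show False by auto
qed

lemma deriv_at_conj_argmax:
  assumes "0 < conj_argmax y"
  shows "deriv g (conj_argmax y) = y"
proof -
  let ?t = "conj_argmax y"
  have "((\<lambda>s. s * y - g s) has_real_derivative y - deriv g ?t) (at ?t)"
    using has_derivative_g[OF assms] by (auto intro!: derivative_eq_intros)
  moreover have "\<forall>s. \<bar>?t - s\<bar> < ?t \<longrightarrow> s * y - g s \<le> ?t * y - g ?t"
    using conj_argmax_best pos_dom by (simp add: abs_if)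
  ultimately have "y - deriv g ?t = 0"
    using DERIV_local_max assms by blast
  then show ?thesis by simp
qed

text \<open>The first-order condition recovers the slope from a positive maximizer. At 0 it may
  fail, since a half-line of slopes can share the maximizer 0.\<close>

lemma conj_argmax_inj_pos:
  assumes "conj_argmax x = conj_argmax y" "0 < conj_argmax x"
  shows "x = y"
proof -
  have "x = deriv g (conj_argmax x)"
    using deriv_at_conj_argmax[OF assms(2)] by (rule sym)
  also have "\<dots> = y"
    unfolding assms(1) using assms(2) unfolding assms(1) by (rule deriv_at_conj_argmax)
  finally show ?thesis .
qed

lemma conj_argmax_less_imp: "conj_argmax x < conj_argmax y \<Longrightarrow> x < y"
  using conj_argmax_mono[of y x] by linarith

text \<open>A monotone function whose range contains \<open>(0, \<infinity>)\<close> and lies in \<open>[0, \<infinity>)\<close> cannot jump.\<close>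

lemma isCont_conj_argmax: "isCont conj_argmax y"
  unfolding isCont_def
proof (rule order_tendstoI)
  fix a assume a: "a < conj_argmax y"
  show "\<forall>\<^sub>F x in at y. a < conj_argmax x"
  proof (cases "a < 0")
    case True
    then show ?thesis
      using conj_argmax_nonneg by (auto intro!: always_eventually intro: less_le_trans)
  next
    case False
    \<comment> \<open>Being positive, \<open>b\<close> is the value of \<open>conj_argmax\<close> at
      \<open>deriv g b\<close>; by monotonicity the slopes above \<open>deriv g b\<close> form the
      required neighbourhood.\<close>
    define b where "b = (a + conj_argmax y) / 2"
    have b: "a < b" "b < conj_argmax y" "0 < b"
      using a False by (auto simp: b_def)
    have less: "deriv g b < y"
      using b by (metis conj_argmax_less_imp conj_argmax_deriv)
    have "a < conj_argmax x" if "deriv g b < x" for x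
      using conj_argmax_mono[of "deriv g b" x] conj_argmax_deriv[of b] b that by simp
    then show ?thesis
      using less by (intro eventually_at_topological[THEN iffD2] exI[of _ "{deriv g b<..}"]) auto
  qed
next
  fix a assume a: "conj_argmax y < a"
  define b where "b = (a + conj_argmax y) / 2"
  have b: "b < a" "conj_argmax y < b" "0 < b"
    using a conj_argmax_nonneg[of y] by (auto simp: b_def)
  have less: "y < deriv g b"
    using b by (metis conj_argmax_less_imp conj_argmax_deriv)
  have "conj_argmax x < a" if "x < deriv g b" for x
    using conj_argmax_mono[of x "deriv g b"] conj_argmax_deriv[of b] b that by simp
  then show "\<forall>\<^sub>F x in at y. conj_argmax x < a"
    using less by (intro eventually_at_topological[THEN iffD2] exI[of _ "{..<deriv g b}"]) auto
qed

section \<open>The conjugate as a finite real function\<close>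

definition conj_real :: "real \<Rightarrow> real" where
  "conj_real y = conj_argmax y * y - g (conj_argmax y)"

lemma conj_real_ge: "t \<in> dom \<Longrightarrow> t * y - g t \<le> conj_real y"
  by (simp add: conj_real_def conj_argmax_best)

text \<open>Arguments outside \<open>dom\<close> contribute \<open>-\<infinity>\<close>, so the
  supremum is the maximum over \<open>dom\<close>. In particular the conjugate is finite at every
  slope.\<close>

lemma fenchel_conj_eq: "fenchel_conj (extend_inf f) y = ereal (conj_real y)"
  unfolding fenchel_conj_def
proof (rule antisym)
  show "(SUP t. ereal (t * y) - extend_inf f t) \<le> ereal (conj_real y)"
  proof (rule SUP_least)
    fix t
    consider "t < 0" | "0 \<le> t" "t \<notin> dom" | "t \<in> dom" by linarith
    then show "ereal (t * y) - extend_inf f t \<le> ereal (conj_real y)"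
    proof cases
      case 3
      then show ?thesis
        using conj_real_ge[of t y] dom_nonneg[of t] by (simp add: extend_inf_def f_eq_g)
    qed (simp_all add: extend_inf_def f_outside)
  qed
  have eq: "ereal (conj_real y) = ereal (conj_argmax y * y) - extend_inf f (conj_argmax y)"
    using conj_argmax_nonneg[of y] f_eq_g[OF conj_argmax_dom[of y]]
    by (simp add: extend_inf_def conj_real_def)
  show "ereal (conj_real y) \<le> (SUP t. ereal (t * y) - extend_inf f t)"
    unfolding eq by (rule SUP_upper) simp
qed

text \<open>The competitor \<open>t = 1\<close>, where \<open>f\<close> vanishes, gives the lower
  bound used for integrability.\<close>

lemma conj_real_ge_id: "y \<le> conj_real y"
  using conj_real_ge[of 1 y] pos_dom[of 1] by (simp add: g_one)

lemma conj_real_mono: "x \<le> y \<Longrightarrow> conj_real x \<le> conj_real y"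
  using conj_real_ge[OF conj_argmax_dom, of x y]
    mult_left_mono[of x y "conj_argmax x"] conj_argmax_nonneg[of x]
  by (simp add: conj_real_def)

end

section \<open>Extended integrals: agreement with Bochner integrals, monotonicity, minorants\<close>

lemma ext_integral_eq_AE:
  assumes "g \<in> borel_measurable M" "integrable M r" "AE z in M. g z = ereal (r z)"
  shows "ext_integral M g = ereal (\<integral>z. r z \<partial>M)"
proof -
  have "(\<integral>\<^sup>+z. e2ennreal (g z) \<partial>M) = (\<integral>\<^sup>+z. ennreal (r z) \<partial>M)"
    "(\<integral>\<^sup>+z. e2ennreal (- g z) \<partial>M) = (\<integral>\<^sup>+z. ennreal (- r z) \<partial>M)"
    using assms(3) by (auto intro!: nn_integral_cong_AE simp: e2ennreal_ereal)
  moreover have "(\<integral>\<^sup>+z. ennreal (r z) \<partial>M) \<noteq> \<infinity>" "(\<integral>\<^sup>+z. ennreal (- r z) \<partial>M) \<noteq> \<infinity>"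
    using assms(2) by (auto simp: real_integrable_def)
  ultimately show ?thesis
    using real_lebesgue_integral_def[OF assms(2)]
    by (cases "\<integral>\<^sup>+z. ennreal (r z) \<partial>M"; cases "\<integral>\<^sup>+z. ennreal (- r z) \<partial>M")
      (simp_all add: ext_integral_def)
qed

text \<open>Positive parts grow and negative parts shrink. Subtraction in \<open>ereal\<close>
  respects this even for infinite values, because
  \<open>\<infinity> - \<infinity> = \<infinity>\<close>.\<close>

lemma ext_integral_mono_AE:
  assumes "AE z in M. g z \<le> h z"
  shows "ext_integral M g \<le> ext_integral M h"
proof -
  have "(\<integral>\<^sup>+z. e2ennreal (g z) \<partial>M) \<le> (\<integral>\<^sup>+z. e2ennreal (h z) \<partial>M)"
    "(\<integral>\<^sup>+z. e2ennreal (- h z) \<partial>M) \<le> (\<integral>\<^sup>+z. e2ennreal (- g z) \<partial>M)"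
    using assms by (auto intro!: nn_integral_mono_AE e2ennreal_mono)
  then show ?thesis
    unfolding ext_integral_def
    by (intro ereal_minus_mono) (simp_all only: less_eq_ennreal.rep_eq)
qed

lemma ext_integrable_ge:
  assumes "g \<in> borel_measurable M" "integrable M r" "AE z in M. ereal (r z) \<le> g z"
  shows "ext_integrable M g"
proof -
  have "(\<integral>\<^sup>+z. e2ennreal (- g z) \<partial>M) \<le> (\<integral>\<^sup>+z. ennreal (- r z) \<partial>M)"
  proof (rule nn_integral_mono_AE)
    show "AE z in M. e2ennreal (- g z) \<le> ennreal (- r z)"
      using assms(3)
    proof eventually_elim
      case (elim z)
      then have "e2ennreal (- g z) \<le> e2ennreal (- ereal (r z))"
        by (intro e2ennreal_mono) (simp only: ereal_minus_le_minus)
      then show ?case by (simp add: e2ennreal_ereal)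
    qed
  qed
  also have "\<dots> < \<infinity>"
    using assms(2) by (auto simp: real_integrable_def less_top)
  finally show ?thesis
    using assms(1) by (simp add: ext_integrable_def)
qed

section \<open>Loss, slopes and tilted densities: measurability and integrability\<close>

locale penalized_risk = divergence_fn f + prob_space M
  for f :: "real \<Rightarrow> ereal" and M :: "'a measure" +
  fixes \<alpha> :: real and l :: "'a \<Rightarrow> ereal"
  assumes alpha_pos: "0 < \<alpha>"
    and l_not_MInf: "\<And>z. z \<in> space M \<Longrightarrow> l z \<noteq> -\<infinity>"
    and l_L1: "ereal_L1 M l"
    and l_bounded_below: "\<exists>c::real. AE z in M. ereal c \<le> l z"
begin

definition loss :: "'a \<Rightarrow> real" where "loss z = real_of_ereal (l z)"

definition slope :: "real \<Rightarrow> 'a \<Rightarrow> real" where "slope lam z = - (loss z + lam) / \<alpha>"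

text \<open>This is \<open>u_\<lambda>\<close> in a form built from measurable functions; it agrees
  with \<open>scalar_minimizer\<close> wherever \<open>l\<close> is finite, hence almost
  everywhere.\<close>

definition tilt :: "real \<Rightarrow> 'a \<Rightarrow> real" where "tilt lam z = conj_argmax (slope lam z)"

definition mass :: "real \<Rightarrow> real" where "mass lam = (\<integral>z. tilt lam z \<partial>M)"

lemma l_measurable [measurable]: "l \<in> borel_measurable M"
  using l_L1 by (simp add: ereal_L1_def)

lemma loss_measurable [measurable]: "loss \<in> borel_measurable M"
  unfolding loss_def[abs_def] by measurable

lemma slope_measurable [measurable]: "slope lam \<in> borel_measurable M"
  unfolding slope_def[abs_def] by measurable

lemma tilt_measurable [measurable]: "tilt lam \<in> borel_measurable M"
proof -
  have "conj_argmax \<in> borel_measurable borel"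
    by (intro borel_measurable_continuous_onI continuous_at_imp_continuous_on ballI
        isCont_conj_argmax)
  then show ?thesis
    unfolding tilt_def[abs_def] by measurable
qed

lemma conj_slope_measurable [measurable]:
  "(\<lambda>z. conj_real (slope lam z)) \<in> borel_measurable M"
proof -
  have "conj_real \<in> borel_measurable borel"
    by (intro borel_measurable_mono monoI conj_real_mono)
  then show ?thesis by measurable
qed

lemma l_eq_loss: "z \<in> space M \<Longrightarrow> l z < \<infinity> \<Longrightarrow> l z = ereal (loss z)"
  using l_not_MInf[of z] by (cases "l z") (simp_all add: loss_def)

lemma AE_l_eq_loss: "AE z in M. l z = ereal (loss z)"
proof -
  have "(\<integral>\<^sup>+z. e2ennreal \<bar>l z\<bar> \<partial>M) \<noteq> \<infinity>"
    using l_L1 by (simp add: ereal_L1_def)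
  then have "AE z in M. e2ennreal \<bar>l z\<bar> \<noteq> \<infinity>"
    by (intro nn_integral_PInf_AE) simp_all
  then show ?thesis
    using AE_space
  proof eventually_elim
    case (elim z)
    then have "l z \<noteq> \<infinity>" by auto
    with elim show ?case by (intro l_eq_loss) auto
  qed
qed

lemma integrable_loss: "integrable M loss"
proof (rule integrableI_bounded)
  have "(\<integral>\<^sup>+z. ennreal (norm (loss z)) \<partial>M) = (\<integral>\<^sup>+z. e2ennreal \<bar>l z\<bar> \<partial>M)"
    using AE_l_eq_loss by (intro nn_integral_cong_AE) (auto simp: e2ennreal_ereal)
  then show "(\<integral>\<^sup>+z. ennreal (norm (loss z)) \<partial>M) < \<infinity>"
    using l_L1 by (simp add: ereal_L1_def)
qed simp

lemma integrable_slope: "integrable M (slope lam)"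
  unfolding slope_def[abs_def] using integrable_loss by simp

lemma loss_bounded_below:
  obtains c where "AE z in M. c \<le> loss z"
proof -
  from l_bounded_below obtain c where "AE z in M. ereal c \<le> l z" by blast
  then have "AE z in M. c \<le> loss z"
    using AE_l_eq_loss by eventually_elim simp
  then show ?thesis by (rule that)
qed

lemma alpha_slope: "\<alpha> * slope lam z = - (loss z + lam)"
  using alpha_pos by (simp add: slope_def)

lemma slope_mono: "c + b \<le> loss z + lam \<Longrightarrow> slope lam z \<le> (- c - b) / \<alpha>"
  using alpha_pos by (simp add: slope_def divide_right_mono)

lemma tilt_nonneg: "0 \<le> tilt lam z"
  by (simp add: tilt_def conj_argmax_nonneg)

text \<open>A lower bound on the loss bounds the slope above, hence the tilt, uniformly in
  \<open>lam \<ge> b\<close>. The bound is the dominating constant for integrability and for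
  dominated convergence.\<close>

lemma tilt_le: "c \<le> loss z \<Longrightarrow> b \<le> lam \<Longrightarrow> tilt lam z \<le> conj_argmax ((- c - b) / \<alpha>)"
  unfolding tilt_def by (intro conj_argmax_mono slope_mono) simp

text \<open>For \<open>c = loss z\<close> the bound in \<open>tilt_le\<close> is
  \<open>tilt b z\<close> itself.\<close>

lemma tilt_antimono: "b \<le> lam \<Longrightarrow> tilt lam z \<le> tilt b z"
  using tilt_le[of "loss z" z b lam] by (simp add: tilt_def slope_def)

lemma integrable_tilt: "integrable M (tilt lam)"
proof -
  obtain c where "AE z in M. c \<le> loss z" by (rule loss_bounded_below)
  then have "AE z in M. norm (tilt lam z) \<le> conj_argmax ((- c - lam) / \<alpha>)"
    by eventually_elim (simp add: tilt_nonneg tilt_le)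
  then show ?thesis
    by (intro integrable_const_bound) simp_all
qed

text \<open>The conjugate lies between the integrable slope and the constant \<open>B\<close>, which
  bounds it because the loss is bounded below.\<close>

lemma integrable_conj_slope: "integrable M (\<lambda>z. conj_real (slope lam z))"
proof -
  obtain c where c: "AE z in M. c \<le> loss z" by (rule loss_bounded_below)
  define B where "B = conj_real ((- c - lam) / \<alpha>)"
  show ?thesis
  proof (rule Bochner_Integration.integrable_bound)
    show "integrable M (\<lambda>z. \<bar>slope lam z\<bar> + \<bar>B\<bar>)"
      using integrable_slope by simp
    show "AE z in M. norm (conj_real (slope lam z)) \<le> norm (\<bar>slope lam z\<bar> + \<bar>B\<bar>)"
      using c
    proof eventually_elim
      case (elim z)
      then have "slope lam z \<le> (- c - lam) / \<alpha>"
        by (intro slope_mono) simp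
      then have "conj_real (slope lam z) \<le> B"
        unfolding B_def by (rule conj_real_mono)
      then show ?case
        using conj_real_ge_id[of "slope lam z"] by simp
    qed
  qed simp
qed

section \<open>Total mass as a function of the multiplier\<close>

lemma mass_antimono: "b \<le> lam \<Longrightarrow> mass lam \<le> mass b"
  unfolding mass_def by (intro integral_mono integrable_tilt tilt_antimono)

text \<open>On an interval the left end \<open>a\<close> bounds all multipliers below, so one
  constant dominates all the tilts and dominated convergence applies.\<close>

lemma continuous_on_mass: "continuous_on {a..b} mass"
proof (rule continuous_on_sequentiallyI)
  fix x :: "nat \<Rightarrow> real" and y
  assume x: "\<forall>n. x n \<in> {a..b}" and lim: "x \<longlonglongrightarrow> y"
  obtain c where c: "AE z in M. c \<le> loss z" by (rule loss_bounded_below)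
  show "(\<lambda>n. mass (x n)) \<longlonglongrightarrow> mass y"
    unfolding mass_def
  proof (rule integral_dominated_convergence)
    show "integrable M (\<lambda>_. conj_argmax ((- c - a) / \<alpha>))" by simp
    show "AE z in M. (\<lambda>n. tilt (x n) z) \<longlonglongrightarrow> tilt y z"
    proof (rule AE_I2)
      fix z
      have "(\<lambda>n. slope (x n) z) \<longlonglongrightarrow> slope y z"
        unfolding slope_def using lim alpha_pos by (intro tendsto_intros) simp_all
      then show "(\<lambda>n. tilt (x n) z) \<longlonglongrightarrow> tilt y z"
        unfolding tilt_def by (rule isCont_tendsto_compose[OF isCont_conj_argmax])
    qed
    show "AE z in M. norm (tilt (x n) z) \<le> conj_argmax ((- c - a) / \<alpha>)" for n
      using c by eventually_elim (use x in \<open>simp add: tilt_nonneg tilt_le\<close>)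
  qed simp_all
qed

text \<open>With \<open>lam = - c\<close> almost all slopes are at most 0, so the tilt is at most
  \<open>conj_argmax 0 = 1\<close>.\<close>

lemma ex_mass_le_one: "\<exists>lam. mass lam \<le> 1"
proof -
  obtain c where "AE z in M. c \<le> loss z" by (rule loss_bounded_below)
  then have "AE z in M. tilt (- c) z \<le> 1"
    by eventually_elim (use tilt_le[of c _ "- c" "- c"] in \<open>simp add: conj_argmax_zero\<close>)
  then have "mass (- c) \<le> (\<integral>z. 1 \<partial>M)"
    unfolding mass_def by (intro integral_mono_AE integrable_tilt) simp_all
  then show ?thesis by (auto simp: prob_space)
qed

text \<open>The event \<open>loss \<le> n\<close> has probability above \<open>1/2\<close> for large \<open>n\<close>, and for small \<open>lam\<close>
  the tilt is at least \<open>2\<close> on it.\<close>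

lemma ex_mass_ge_one: "\<exists>lam. 1 \<le> mass lam"
proof -
  define A where "A n = {z \<in> space M. loss z \<le> real n}" for n
  have A_sets [measurable]: "A n \<in> sets M" for n
    unfolding A_def by measurable
  have "(\<lambda>n. prob (A n)) \<longlonglongrightarrow> prob (\<Union>n. A n)"
    by (rule finite_Lim_measure_incseq) (auto simp: A_def incseq_def)
  also have "(\<Union>n. A n) = space M"
    using real_arch_simple by (auto simp: A_def)
  finally have "(\<lambda>n. prob (A n)) \<longlonglongrightarrow> 1"
    by (simp only: prob_space)
  then have "\<forall>\<^sub>F n in sequentially. 1/2 < prob (A n)"
    by (rule order_tendstoD) simp
  then obtain n where n: "1/2 < prob (A n)"
    using eventually_happens'[OF sequentially_bot] by blast
  \<comment> \<open>This choice makes the slope equal to \<open>deriv g 2\<close> when the loss is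
    \<open>n\<close>, and at least that on all of \<open>A n\<close>.\<close>
  define lam where "lam = - real n - \<alpha> * deriv g 2"
  have "2 * indicator (A n) z \<le> tilt lam z" for z
  proof (cases "z \<in> A n")
    case True
    then have "deriv g 2 \<le> slope lam z"
      using alpha_pos by (simp add: A_def slope_def lam_def field_simps)
    then have "conj_argmax (deriv g 2) \<le> tilt lam z"
      unfolding tilt_def by (rule conj_argmax_mono)
    then show ?thesis
      using True conj_argmax_deriv[of 2] by simp
  qed (simp add: tilt_nonneg)
  then have "(\<integral>z. 2 * indicator (A n) z \<partial>M) \<le> mass lam"
    unfolding mass_def by (intro integral_mono integrable_tilt) (simp_all add: less_top[symmetric])
  then have "2 * prob (A n) \<le> mass lam"
    by simp
  then show ?thesis
    using n by (intro exI[of _ lam]) simp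
qed

lemma ex_mass_one: "\<exists>lam. mass lam = 1"
proof -
  obtain a b where ab: "1 \<le> mass a" "mass b \<le> 1"
    using ex_mass_ge_one ex_mass_le_one by blast
  \<comment> \<open>The order of \<open>a\<close> and \<open>b\<close> is unknown;
    \<open>min a b\<close> is a valid left end, and its mass is still at least 1.\<close>
  have "1 \<le> mass (min a b)"
    using ab mass_antimono[of "min a b" a] by simp
  then show ?thesis
    using IVT2'[of mass b 1 "min a b"] ab continuous_on_mass by auto
qed

text \<open>For \<open>a < b\<close>, ordered tilts with equal integrals agree almost everywhere.
  The slopes differ, so injectivity at positive values forces both tilts to be 0, against mass
  1.\<close>

lemma mass_one_not_less:
  assumes "mass a = 1" "mass b = 1"
  shows "\<not> a < b"
proof
  assume less: "a < b"
  have "(\<integral>z. tilt a z - tilt b z \<partial>M) = 0"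
    using assms integrable_tilt by (simp add: mass_def)
  moreover have "integrable M (\<lambda>z. tilt a z - tilt b z)"
    using integrable_tilt by simp
  ultimately have "AE z in M. tilt a z - tilt b z = 0"
    using integral_nonneg_eq_0_iff_AE[of M "\<lambda>z. tilt a z - tilt b z"]
      tilt_antimono[of a b] less by simp
  then have "AE z in M. tilt a z = 0"
  proof eventually_elim
    case (elim z)
    have "slope a z \<noteq> slope b z"
      using less alpha_pos by (simp add: slope_def)
    then have "\<not> 0 < tilt a z"
      using elim conj_argmax_inj_pos[of "slope a z" "slope b z"] by (auto simp: tilt_def)
    then show ?case
      using tilt_nonneg[of a z] by simp
  qed
  then have "mass a = (\<integral>z. 0 \<partial>M)"
    unfolding mass_def by (intro integral_cong_AE) simp_all
  then show False
    using assms by simp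
qed

lemma ex1_mass_one: "\<exists>!lam. mass lam = 1"
proof -
  obtain a where a: "mass a = 1" using ex_mass_one by blast
  then show ?thesis
    using mass_one_not_less by (intro ex1I[of _ a]) (auto simp: not_less intro!: antisym)
qed

section \<open>The scalar minimization problem\<close>

lemma scalar_objective_dom:
  assumes "z \<in> space M" "l z < \<infinity>" "t \<in> dom"
  shows "scalar_objective \<alpha> l f lam z t = ereal (- \<alpha> * (t * slope lam z - g t))"
  using assms alpha_pos
  by (simp add: scalar_objective_def l_eq_loss f_eq_g slope_def field_simps)

lemma scalar_objective_outside:
  assumes "z \<in> space M" "l z < \<infinity>" "0 \<le> t" "t \<notin> dom"
  shows "scalar_objective \<alpha> l f lam z t = \<infinity>"
  using assms alpha_pos by (simp add: scalar_objective_def l_eq_loss f_outside)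

lemma is_arg_min_iff:
  assumes z: "z \<in> space M" "l z < \<infinity>"
  shows "is_arg_min (scalar_objective \<alpha> l f lam z) (\<lambda>t. 0 \<le> t) t \<longleftrightarrow> t = tilt lam z"
proof
  assume min: "is_arg_min (scalar_objective \<alpha> l f lam z) (\<lambda>t. 0 \<le> t) t"
  then have t: "0 \<le> t"
    and le: "\<And>s. 0 \<le> s \<Longrightarrow> scalar_objective \<alpha> l f lam z t \<le> scalar_objective \<alpha> l f lam z s"
    by (simp_all add: is_arg_min_linorder)
  have t_dom: "t \<in> dom"
  proof (rule ccontr)
    assume "t \<notin> dom"
    then show False
      using le[of 1] scalar_objective_outside[OF z t, of lam]
        scalar_objective_dom[OF z pos_dom[of 1], of lam] by simp
  qed
  have "s * slope lam z - g s \<le> t * slope lam z - g t" if "s \<in> dom" for s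
    using le[OF dom_nonneg[OF that]] alpha_pos
    by (simp add: scalar_objective_dom[OF z that] scalar_objective_dom[OF z t_dom])
  then show "t = tilt lam z"
    unfolding tilt_def using t_dom
    by (intro conj_argmax_eqI[symmetric]) (simp add: conj_maximizer_def)
next
  assume t: "t = tilt lam z"
  have t_dom: "t \<in> dom"
    unfolding t tilt_def by (rule conj_argmax_dom)
  have "scalar_objective \<alpha> l f lam z t \<le> scalar_objective \<alpha> l f lam z s" if "0 \<le> s" for s
  proof (cases "s \<in> dom")
    case True
    have "s * slope lam z - g s \<le> t * slope lam z - g t"
      unfolding t tilt_def by (rule conj_argmax_best[OF True])
    then show ?thesis
      using alpha_pos by (simp add: scalar_objective_dom[OF z True] scalar_objective_dom[OF z t_dom])
  qed (simp add: scalar_objective_outside[OF z that])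
  then show "is_arg_min (scalar_objective \<alpha> l f lam z) (\<lambda>t. 0 \<le> t) t"
    using t tilt_nonneg by (simp add: is_arg_min_linorder)
qed

lemma scalar_minimizer_eq_tilt:
  "z \<in> space M \<Longrightarrow> l z < \<infinity> \<Longrightarrow> scalar_minimizer \<alpha> l f lam z = tilt lam z"
  by (simp add: scalar_minimizer_def arg_min_def is_arg_min_iff)

text \<open>On \<open>{l = \<infinity>}\<close> the minimizer may be an arbitrary choice, but it is the same choice for all
  points of that set.\<close>

lemma scalar_minimizer_measurable [measurable]:
  "scalar_minimizer \<alpha> l f lam \<in> borel_measurable M"
proof -
  define k where "k = arg_min (\<lambda>t. ereal \<alpha> * f t + (\<infinity> + ereal lam) * ereal t) (\<lambda>t. 0 \<le> t)"
  have "scalar_minimizer \<alpha> l f lam z = (if l z = \<infinity> then k else tilt lam z)"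
    if "z \<in> space M" for z
  proof (cases "l z = \<infinity>")
    case True
    then have "scalar_objective \<alpha> l f lam z = (\<lambda>t. ereal \<alpha> * f t + (\<infinity> + ereal lam) * ereal t)"
      by (simp add: scalar_objective_def[abs_def])
    then show ?thesis
      using True by (simp add: scalar_minimizer_def k_def)
  next
    case False
    then show ?thesis
      using that by (simp add: scalar_minimizer_eq_tilt less_top)
  qed
  then show ?thesis
    by (subst measurable_cong[where g = "\<lambda>z. if l z = \<infinity> then k else tilt lam z"]) simp_all
qed

text \<open>The minimizer and the tilt can differ only on the null set where \<open>l\<close> is
  infinite.\<close>

lemma has_integral_scalar_minimizer_iff:
  "has_bochner_integral M (scalar_minimizer \<alpha> l f lam) 1 \<longleftrightarrow> mass lam = 1"
proof -
  have "AE z in M. scalar_minimizer \<alpha> l f lam z = tilt lam z"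
    using AE_l_eq_loss AE_space by eventually_elim (simp add: scalar_minimizer_eq_tilt)
  then have "has_bochner_integral M (scalar_minimizer \<alpha> l f lam) 1
      \<longleftrightarrow> has_bochner_integral M (tilt lam) 1"
    by (intro has_bochner_integral_cong_AE) simp_all
  then show ?thesis
    using integrable_tilt by (simp add: has_bochner_integral_iff mass_def)
qed

section \<open>Dual and primal integrands\<close>

lemma dual_integrand_eq: "dual_integrand \<alpha> l f lam z = ereal (conj_real (slope lam z))"
  by (simp add: dual_integrand_def fenchel_conj_eq slope_def loss_def)

lemma dual_integrand_integrable: "ext_integrable M (dual_integrand \<alpha> l f lam)"
  unfolding dual_integrand_eq[abs_def]
  by (rule ext_integrable_ge[OF _ integrable_conj_slope[of lam]]) simp_all

lemma dual_objective_eq: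
  "dual_objective M \<alpha> l f lam = ereal (- lam - \<alpha> * (\<integral>z. conj_real (slope lam z) \<partial>M))"
proof -
  have "ext_integral M (dual_integrand \<alpha> l f lam) = ereal (\<integral>z. conj_real (slope lam z) \<partial>M)"
    unfolding dual_integrand_eq[abs_def]
    by (rule ext_integral_eq_AE[OF _ integrable_conj_slope]) simp_all
  then show ?thesis by (simp add: dual_objective_def)
qed

lemma primal_integrand_measurable:
  assumes "v \<in> unit_densities M"
  shows "primal_integrand \<alpha> l f v \<in> borel_measurable M"
proof -
  have v [measurable]: "v \<in> borel_measurable M" and nonneg: "\<And>z. z \<in> space M \<Longrightarrow> 0 \<le> v z"
    using assms by (auto simp: unit_densities_def)
  \<comment> \<open>Nothing is known of \<open>f\<close> at negative arguments; truncation at 0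
    gives a continuous function on the whole line that agrees with \<open>f\<close> along
    \<open>v \<ge> 0\<close>.\<close>
  have "continuous_on UNIV (\<lambda>t. f (max 0 t))"
    by (rule continuous_on_compose2[OF continuous_on_f]) (auto intro!: continuous_intros)
  then have [measurable]: "(\<lambda>t. f (max 0 t)) \<in> borel_measurable borel"
    by (rule borel_measurable_continuous_onI)
  have "(\<lambda>z. (\<lambda>t. f (max 0 t)) (v z)) \<in> borel_measurable M"
    by measurable
  then have "(\<lambda>z. l z * ereal (v z) + ereal \<alpha> * f (max 0 (v z))) \<in> borel_measurable M"
    by measurable
  moreover have "primal_integrand \<alpha> l f v z = l z * ereal (v z) + ereal \<alpha> * f (max 0 (v z))"
    if "z \<in> space M" for z
    using nonneg[OF that] by (simp add: primal_integrand_def max_def)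
  ultimately show ?thesis
    by (simp cong: measurable_cong)
qed

lemma primal_integrand_dom:
  assumes "l z = ereal (loss z)" "v z \<in> dom"
  shows "primal_integrand \<alpha> l f v z = ereal (loss z * v z + \<alpha> * g (v z))"
  using assms by (simp add: primal_integrand_def f_eq_g)

lemma primal_integrand_outside:
  assumes "l z = ereal (loss z)" "0 \<le> v z" "v z \<notin> dom"
  shows "primal_integrand \<alpha> l f v z = \<infinity>"
  using assms alpha_pos by (simp add: primal_integrand_def f_outside)

text \<open>As \<open>f\<close> and \<open>v\<close> are nonnegative, \<open>c * v\<close> is an
  integrable minorant for any almost sure lower bound \<open>c\<close> of the loss.\<close>

lemma primal_integrand_integrable:
  assumes v: "v \<in> unit_densities M"
  shows "ext_integrable M (primal_integrand \<alpha> l f v)"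
proof -
  obtain c where c: "AE z in M. c \<le> loss z" by (rule loss_bounded_below)
  have int: "integrable M (\<lambda>z. c * v z)"
    using v by (auto simp: unit_densities_def has_bochner_integral_iff)
  have "AE z in M. ereal (c * v z) \<le> primal_integrand \<alpha> l f v z"
    using c AE_l_eq_loss AE_space
  proof eventually_elim
    case (elim z)
    have nonneg: "0 \<le> v z" using v elim by (auto simp: unit_densities_def)
    show ?case
    proof (cases "v z \<in> dom")
      case True
      have "c * v z \<le> loss z * v z" "0 \<le> \<alpha> * g (v z)"
        using elim nonneg alpha_pos g_nonneg[OF True] by (auto intro: mult_right_mono)
      then show ?thesis
        using primal_integrand_dom[of z v] True elim by simp
    qed (use elim nonneg in \<open>simp add: primal_integrand_outside\<close>)
  qed
  with primal_integrand_measurable[OF v] int show ?thesis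
    by (rule ext_integrable_ge)
qed

section \<open>Weak and strong duality\<close>

lemma integral_lagrangian:
  assumes "has_bochner_integral M v 1"
  shows "integrable M (\<lambda>z. - \<alpha> * conj_real (slope lam z) - lam * v z)"
    and "ereal (\<integral>z. - \<alpha> * conj_real (slope lam z) - lam * v z \<partial>M) = dual_objective M \<alpha> l f lam"
  using assms integrable_conj_slope[of lam]
  by (simp_all add: has_bochner_integral_iff dual_objective_eq)

lemma weak_duality:
  assumes v: "v \<in> unit_densities M"
  shows "dual_objective M \<alpha> l f lam \<le> ext_integral M (primal_integrand \<alpha> l f v)"
proof -
  have v1: "has_bochner_integral M v 1"
    using v by (simp add: unit_densities_def)
  then have v_meas [measurable]: "v \<in> borel_measurable M"
    by (auto simp: has_bochner_integral_iff)
  let ?r = "\<lambda>z. - \<alpha> * conj_real (slope lam z) - lam * v z"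
  have "AE z in M. ereal (?r z) \<le> primal_integrand \<alpha> l f v z"
    using AE_l_eq_loss AE_space
  proof eventually_elim
    case (elim z)
    have nonneg: "0 \<le> v z" using v elim by (auto simp: unit_densities_def)
    show ?case
    proof (cases "v z \<in> dom")
      case True
      \<comment> \<open>This is the Fenchel-Young inequality scaled by \<open>\<alpha>\<close>;
        substituting \<open>\<alpha> * slope lam z = - (loss z + lam)\<close> turns it into the
        claimed minorant.\<close>
      have "\<alpha> * (v z * slope lam z - g (v z)) \<le> \<alpha> * conj_real (slope lam z)"
        using conj_real_ge[OF True] alpha_pos by (intro mult_left_mono) auto
      moreover have "\<alpha> * (v z * slope lam z - g (v z)) = v z * (\<alpha> * slope lam z) - \<alpha> * g (v z)"
        by (simp add: algebra_simps)
      ultimately show ?thesis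
        using primal_integrand_dom[of z v] True elim by (simp add: alpha_slope algebra_simps)
    qed (use elim nonneg in \<open>simp add: primal_integrand_outside\<close>)
  qed
  then have "ext_integral M (\<lambda>z. ereal (?r z)) \<le> ext_integral M (primal_integrand \<alpha> l f v)"
    by (rule ext_integral_mono_AE)
  moreover have "ext_integral M (\<lambda>z. ereal (?r z)) = ereal (\<integral>z. ?r z \<partial>M)"
    by (rule ext_integral_eq_AE[OF _ integral_lagrangian(1)[OF v1]]) simp_all
  ultimately show ?thesis
    using integral_lagrangian(2)[OF v1, of lam] by simp
qed

lemma tilt_unit_density: "mass lam = 1 \<Longrightarrow> tilt lam \<in> unit_densities M"
  using integrable_tilt tilt_nonneg
  by (simp add: unit_densities_def has_bochner_integral_iff mass_def)

text \<open>The tilt is the maximizer at its slope, so Fenchel-Young holds with equality at every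
  point; mass 1 makes the tilt admissible.\<close>

lemma strong_duality:
  assumes "mass lam = 1"
  shows "ext_integral M (primal_integrand \<alpha> l f (tilt lam)) = dual_objective M \<alpha> l f lam"
proof -
  have v: "tilt lam \<in> unit_densities M"
    using assms by (rule tilt_unit_density)
  then have v1: "has_bochner_integral M (tilt lam) 1"
    by (simp add: unit_densities_def)
  let ?r = "\<lambda>z. - \<alpha> * conj_real (slope lam z) - lam * tilt lam z"
  have "AE z in M. primal_integrand \<alpha> l f (tilt lam) z = ereal (?r z)"
    using AE_l_eq_loss
  proof eventually_elim
    case (elim z)
    have "tilt lam z \<in> dom"
      unfolding tilt_def by (rule conj_argmax_dom)
    moreover have "\<alpha> * conj_real (slope lam z) = tilt lam z * (\<alpha> * slope lam z) - \<alpha> * g (tilt lam z)"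
      by (simp add: conj_real_def tilt_def algebra_simps)
    ultimately show ?case
      using primal_integrand_dom[of z "tilt lam"] elim by (simp add: alpha_slope algebra_simps)
  qed
  then show ?thesis
    using ext_integral_eq_AE[OF primal_integrand_measurable[OF v] integral_lagrangian(1)[OF v1]]
      integral_lagrangian(2)[OF v1, of lam] by simp
qed

text \<open>Weak duality covers every pair of a density and a multiplier, so the pair
  \<open>tilt lam\<close>, \<open>lam\<close> with equal values is optimal on both sides.\<close>

lemma duality:
  assumes "mass lam = 1"
  shows "(INF v\<in>unit_densities M. ext_integral M (primal_integrand \<alpha> l f v))
      = dual_objective M \<alpha> l f lam" (is ?primal)
    and "(SUP b. dual_objective M \<alpha> l f b) = dual_objective M \<alpha> l f lam" (is ?dual)
proof -
  note tilt = tilt_unit_density[OF assms]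
  show ?primal
    by (rule antisym[OF INF_lower2[OF tilt] INF_greatest])
      (simp_all add: strong_duality[OF assms] weak_duality)
  show ?dual
    using weak_duality[OF tilt] strong_duality[OF assms]
    by (intro antisym SUP_least SUP_upper) simp_all
qed

end

theorem corollary2:
  fixes M :: "'a measure" and \<alpha> :: real
    and l :: "'a \<Rightarrow> ereal" and f :: "real \<Rightarrow> ereal"
  assumes "prob_space M"
    and "\<alpha> > 0"
    and "\<forall>z\<in>space M. l z \<noteq> -\<infinity>"
    and "ereal_L1 M l"
    and "\<exists>c::real. AE z in M. ereal c \<le> l z"
    and "proper_on {0..} f"
    and "lsc_on {0..} f"
    and "ereal_convex_on {0..} f"
    and "\<forall>t>0. \<bar>f t\<bar> \<noteq> \<infinity>"
    and "\<forall>t>0. (\<lambda>s. real_of_ereal (f s)) differentiable (at t)"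
    and "ereal_strictly_convex_on {0<..} f"
    and "f 1 = 0"
    and "\<forall>t\<ge>0. f t \<ge> 0 \<and> (f t = 0 \<longrightarrow> t = 1)"
    and "\<exists>d::ereal. d \<noteq> \<infinity> \<and>
           ((\<lambda>t. ereal (deriv (\<lambda>s. real_of_ereal (f s)) t)) \<longlongrightarrow> d) (at_right 0)"
    and "filterlim (deriv (\<lambda>s. real_of_ereal (f s))) at_top at_top"
  shows
    "(\<forall>u\<in>unit_densities M. ext_integrable M (primal_integrand \<alpha> l f u)) \<and>
     (\<forall>lam. ext_integrable M (dual_integrand \<alpha> l f lam)) \<and>
     (INF u\<in>unit_densities M. ext_integral M (primal_integrand \<alpha> l f u))
       = (SUP lam. dual_objective M \<alpha> l f lam) \<and>
     (\<forall>lam. \<forall>z\<in>space M. l z < \<infinity> \<longrightarrow>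
        (\<exists>!t. is_arg_min (scalar_objective \<alpha> l f lam z) (\<lambda>t. 0 \<le> t) t)) \<and>
     (\<exists>!lam. has_bochner_integral M (scalar_minimizer \<alpha> l f lam) 1) \<and>
     (\<forall>lam. has_bochner_integral M (scalar_minimizer \<alpha> l f lam) 1 \<longrightarrow>
        dual_objective M \<alpha> l f lam = (SUP \<mu>. dual_objective M \<alpha> l f \<mu>))"
proof -
  interpret penalized_risk f M \<alpha> l
    using assms
    by (intro penalized_risk.intro penalized_risk_axioms.intro divergence_fn.intro) auto
  obtain lam0 where lam0: "mass lam0 = 1"
    using ex_mass_one by blast
  show ?thesis
  proof (intro conjI ballI allI impI)
    show "(INF u\<in>unit_densities M. ext_integral M (primal_integrand \<alpha> l f u))
        = (SUP lam. dual_objective M \<alpha> l f lam)"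
      using duality[OF lam0] by simp
    show "\<exists>!t. is_arg_min (scalar_objective \<alpha> l f lam z) (\<lambda>t. 0 \<le> t) t"
      if "z \<in> space M" "l z < \<infinity>" for lam z
      using that by (simp add: is_arg_min_iff)
    show "\<exists>!lam. has_bochner_integral M (scalar_minimizer \<alpha> l f lam) 1"
      using ex1_mass_one by (simp add: has_integral_scalar_minimizer_iff)
    show "dual_objective M \<alpha> l f lam = (SUP \<mu>. dual_objective M \<alpha> l f \<mu>)"
      if "has_bochner_integral M (scalar_minimizer \<alpha> l f lam) 1" for lam
      using that duality(2) by (simp add: has_integral_scalar_minimizer_iff)
  qed (simp_all add: primal_integrand_integrable dual_integrand_integrable)
qed

end
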